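(* Let $n\ge1$, $r\in\mathbb{Z}$, and $z_1\ne z_2$ complex numbers. For the bi-bordered $2j-k$ determinant $$F^{(2)}_n(z_1,z_2):=\frac{1}{z_1-z_2}\det\begin{pmatrix}w_r&w_{r-1}&\cdots&w_{r-n+1}&1&1\\ w_{r+2}&w_{r+1}&\cdots&w_{r-n+3}&z_2&z_1\\ w_{r+4}&w_{r+3}&\cdots&w_{r-n+5}&z_2^2&z_1^2\\ \vdots&\vdots&&\vdots&\vdots&\vdots\\ w_{r+2n+2}&w_{r+2n+1}&\cdots&w_{r+n+3}&z_2^{n+1}&z_1^{n+1}\end{pmatrix}$$ it holds that $$F^{(2)}_n(z_1,z_2)=\mathcal{D}_n\left[w(\zeta)\zeta^{-r}(z_1-\zeta^{-2})(z_2-\zeta^{-2})\right].$$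
   Context: $w$ is an integrable weight function on the unit circle $\mathbb{T}$ with moments $w_\ell=\int_{\mathbb{T}} w(\zeta)\zeta^{-\ell}\frac{d\zeta}{2\pi \mathrm{i}\zeta}$, $\ell\in\mathbb{Z}$. The matrix in the claim is $(n+2)\times(n+2)$; its row $j$ ($0\le j\le n+1$) is $(w_{r+2j},w_{r+2j-1},\dots,w_{r+2j-n+1},z_2^j,z_1^j)$. For an integrable function $f$ on $\mathbb{T}$, $$\mathcal{D}_n[f(\zeta)]:=\frac{1}{n!}\int_{\mathbb{T}}\frac{d\zeta_1}{2\pi \mathrm{i}\zeta_1}\cdots\int_{\mathbb{T}}\frac{d\zeta_n}{2\pi \mathrm{i}\zeta_n}\prod_{j=1}^nf(\zeta_j)\prod_{1\le j<k\le n}(\zeta_k-\zeta_j)(\zeta_k^{-2}-\zeta_j^{-2}).$$ *)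

theory Defs
  imports "HOL-Complex_Analysis.Contour_Integration" "Jordan_Normal_Form.Determinant"
begin

text \<open>
  Functions on the unit circle are functions on the complex plane of which only the values on the
  circle matter. Since \<open>circlepath 0 1 t = exp (2 * pi * \<i> * t)\<close>, the following is Lebesgue
  integrability with respect to normalised arc length.
\<close>

definition circle_integrable :: "(complex \<Rightarrow> complex) \<Rightarrow> bool" where
  "circle_integrable f \<longleftrightarrow> (\<lambda>t. f (circlepath 0 1 t)) absolutely_integrable_on {0..1}"

text \<open>
  The library's contour integral is a gauge integral; it coincides with the Lebesgue integral for
  the functions satisfying \<open>circle_integrable\<close>.
\<close>

definition circle_integral :: "(complex \<Rightarrow> complex) \<Rightarrow> complex" where
  "circle_integral f =
     contour_integral (circlepath 0 1) (\<lambda>\<zeta>. f \<zeta> / (2 * of_real pi * \<i> * \<zeta>))"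

definition moment :: "(complex \<Rightarrow> complex) \<Rightarrow> int \<Rightarrow> complex" where
  "moment w l = circle_integral (\<lambda>\<zeta>. w \<zeta> * \<zeta> powi (- l))"

text \<open>
  Iterated integral over the variables \<open>\<zeta> 1, \<dots>, \<zeta> n\<close>, with \<open>\<zeta> 1\<close> outermost
  and \<open>\<zeta> n\<close> innermost. The integrand must depend only on these values of \<open>\<zeta>\<close>;
  the point \<open>\<lambda>_. 0\<close> of the base case is then irrelevant.
\<close>

primrec iterated_circle_integral :: "nat \<Rightarrow> ((nat \<Rightarrow> complex) \<Rightarrow> complex) \<Rightarrow> complex" where
  "iterated_circle_integral 0 F = F (\<lambda>_. 0)"
| "iterated_circle_integral (Suc n) F =
     iterated_circle_integral n (\<lambda>\<zeta>. circle_integral (\<lambda>x. F (\<zeta>(Suc n := x))))"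

definition circle_D :: "nat \<Rightarrow> (complex \<Rightarrow> complex) \<Rightarrow> complex" where
  "circle_D n f = 1 / fact n * iterated_circle_integral n (\<lambda>\<zeta>.
     (\<Prod>j=1..n. f (\<zeta> j)) *
     (\<Prod>(j, k) \<in> {(j, k). 1 \<le> j \<and> j < k \<and> k \<le> n}.
        (\<zeta> k - \<zeta> j) * (\<zeta> k powi (-2) - \<zeta> j powi (-2))))"

definition bibordered_mat ::
  "(complex \<Rightarrow> complex) \<Rightarrow> int \<Rightarrow> nat \<Rightarrow> complex \<Rightarrow> complex \<Rightarrow> complex Matrix.mat" where
  "bibordered_mat w r n z1 z2 = Matrix.mat (n + 2) (n + 2) (\<lambda>(j, k).
     if k < n then moment w (r + 2 * int j - int k)
     else if k = n then z2 ^ j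
     else z1 ^ j)"

definition F2 :: "(complex \<Rightarrow> complex) \<Rightarrow> int \<Rightarrow> nat \<Rightarrow> complex \<Rightarrow> complex \<Rightarrow> complex" where
  "F2 w r n z1 z2 = 1 / (z1 - z2) * Determinant.det (bibordered_mat w r n z1 z2)"

end

theory Submission
  imports Defs
begin

text \<open>
  Put \<open>x\<^sub>k = \<zeta>\<^sub>k\<^sup>-\<^sup>2\<close>. Multiplied by \<open>z1 - z2\<close>, the factors \<open>(z1 - x\<^sub>k) * (z2 - x\<^sub>k)\<close> and the
  differences \<open>x\<^sub>k - x\<^sub>j\<close> of the integrand together form the Vandermonde determinant in the
  \<open>n + 2\<close> nodes \<open>x\<^sub>1, \<dots>, x\<^sub>n, z2, z1\<close> (\<open>det_bordered_vandermonde\<close>), and the differences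
  \<open>\<zeta>\<^sub>k - \<zeta>\<^sub>j\<close> form a second one in \<open>\<zeta>\<^sub>1, \<dots>, \<zeta>\<^sub>n\<close>. Expanding both by the Leibniz formula, over
  permutations \<open>\<sigma>\<close> and \<open>\<tau>\<close>, turns the integrand into a finite linear combination of products of
  one-variable functions \<open>w \<zeta> * \<zeta> powi (- (r + 2 * \<sigma> j - \<tau> j))\<close>
  (\<open>bordered_integrand_expansion\<close>). The iterated integral of such a combination follows from
  linearity alone (\<open>iterated_circle_integral_sum_prod\<close>), with no exchange of integrals, and each
  factor integrates to the moment of index \<open>r + 2 * \<sigma> j - \<tau> j\<close>.

  For a fixed \<open>\<tau>\<close>, the sum over \<open>\<sigma>\<close> is the Leibniz expansion of the bordered moment determinant
  with its first \<open>n\<close> columns permuted by \<open>\<tau>\<close> (\<open>det_bibordered_permuted_columns\<close>). The sign this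
  costs cancels the sign of \<open>\<tau>\<close> from the Vandermonde expansion, so each of the \<open>n!\<close> permutations
  \<open>\<tau>\<close> contributes the same determinant, and \<open>1 / n!\<close> normalises the sum.
\<close>

section \<open>Determinants\<close>

text \<open>
  The monic polynomials \<open>p\<^sub>i = (X - x\<^sub>0) \<cdots> (X - x\<^sub>i\<^sub>-\<^sub>1)\<close> and the monomials are related by a
  unitriangular matrix \<open>L\<close>. So \<open>(x\<^sub>j\<^sup>i)\<close> has the same determinant as \<open>(p\<^sub>i(x\<^sub>j))\<close>, which is
  triangular because \<open>p\<^sub>i\<close> vanishes at every \<open>x\<^sub>j\<close> with \<open>j < i\<close>.
\<close>

lemma det_vandermonde:
  fixes x :: "nat \<Rightarrow> 'a::idom"
  shows "det (mat n n (\<lambda>(i, j). x j ^ i)) = (\<Prod>k<n. \<Prod>j<k. x k - x j)"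
proof -
  define p where "p i = (\<Prod>k<i. [:- x k, 1:])" for i
  have deg: "degree (p i) = i" for i
    unfolding p_def by (subst degree_prod_eq_sum_degree) auto
  have monic: "coeff (p i) i = 1" for i
    using lead_coeff_prod[of "\<lambda>k. [:- x k, 1:]" "{..<i}"] deg[of i] by (simp add: p_def)
  have eval: "poly (p i) y = (\<Prod>k<i. y - x k)" for i y
    by (simp add: p_def poly_prod)
  let ?V = "mat n n (\<lambda>(i, j). x j ^ i)"
  define L where "L = mat n n (\<lambda>(i, l). coeff (p i) l)"
  define P where "P = mat n n (\<lambda>(i, j). poly (p i) (x j))"
  have carrier: "?V \<in> carrier_mat n n" "L \<in> carrier_mat n n" "P \<in> carrier_mat n n"
    by (auto simp: L_def P_def)
  have "det L = prod_list (diag_mat L)"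
    by (rule det_lower_triangular[OF _ carrier(2)]) (auto simp: L_def deg coeff_eq_0)
  then have det_L: "det L = 1"
    using carrier by (simp add: prod_list_diag_prod L_def monic)
  have "upper_triangular P"
    by (auto simp: upper_triangular_def P_def eval)
  then have det_P: "det P = (\<Prod>k<n. \<Prod>j<k. x k - x j)"
    by (subst det_upper_triangular[OF _ carrier(3)])
       (auto simp: prod_list_diag_prod P_def eval atLeast0LessThan)
  have "P = L * ?V"
  proof (rule eq_matI)
    fix i j assume "i < dim_row (L * ?V)" "j < dim_col (L * ?V)"
    then have ij: "i < n" "j < n" by (auto simp: L_def)
    have "poly (p i) (x j) = (\<Sum>l\<le>i. coeff (p i) l * x j ^ l)"
      by (simp add: poly_altdef deg)
    also have "\<dots> = (\<Sum>l\<in>{0..<n}. coeff (p i) l * x j ^ l)"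
      using ij by (intro sum.mono_neutral_left) (auto simp: coeff_eq_0 deg)
    finally show "P $$ (i, j) = (L * ?V) $$ (i, j)"
      using ij by (simp add: P_def L_def scalar_prod_def)
  qed (auto simp: P_def L_def)
  then show ?thesis
    using det_mult[OF carrier(2,1)] det_L det_P by simp
qed

lemma det_mat_columns:
  "det (mat n n (\<lambda>(i, j). f i j))
     = (\<Sum>p | p permutes {0..<n}. signof p * (\<Prod>j<n. f (p j) j :: 'a::comm_ring_1))"
proof -
  have "mat n n (\<lambda>(i, j). f i j) $$ (p j, j) = f (p j) j"
    if "p permutes {0..<n}" "j < n" for p j
    using permutes_in_image[OF that(1), of j] that(2) by simp
  then show ?thesis
    by (subst det_col[of _ n]) auto
qed

lemma det_permute_columns:
  assumes A: "A \<in> carrier_mat n n" and p: "p permutes {0..<n}"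
  shows "det (mat n n (\<lambda>(i, j). A $$ (i, p j))) = signof p * det A"
proof -
  have "p j < n" if "j < n" for j
    using permutes_in_image[OF p, of j] that by simp
  then have "mat n n (\<lambda>(i, j). A $$ (i, p j))
      = transpose_mat (mat n n (\<lambda>(i, j). transpose_mat A $$ (p i, j)))"
    using A by (intro eq_matI) auto
  then show ?thesis
    using A det_permute_rows[OF transpose_carrier_mat[THEN iffD2, OF A] p]
    by (simp add: det_transpose[of _ n])
qed

text \<open>
  The border columns are nodes like the others, so the extra factors are the differences in which
  they take part; \<open>z1 - z2\<close> has this sign because \<open>z1\<close> is the last node.
\<close>

lemma det_bordered_vandermonde:
  fixes x :: "nat \<Rightarrow> 'a::idom"
  shows "det (mat (n + 2) (n + 2)
           (\<lambda>(j, k). (if k < n then x k else if k = n then z2 else z1) ^ j))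
         = (z1 - z2) * (\<Prod>k<n. (z1 - x k) * (z2 - x k)) * (\<Prod>k<n. \<Prod>j<k. x k - x j)"
  by (subst det_vandermonde) (simp add: prod.distrib mult_ac)

lemma prod_pairs_less:
  "(\<Prod>(j, k) \<in> {(j, k). 1 \<le> j \<and> j < k \<and> k \<le> n}. h j k)
     = (\<Prod>k<n. \<Prod>j<k. h (Suc j) (Suc k) :: 'a::comm_monoid_mult)"
proof -
  have "(\<Prod>k<n. \<Prod>j<k. h (Suc j) (Suc k))
      = (\<Prod>(k, j) \<in> Sigma {..<n} lessThan. h (Suc j) (Suc k))"
    by (rule prod.Sigma) auto
  also have "\<dots> = (\<Prod>(j, k) \<in> {(j, k). 1 \<le> j \<and> j < k \<and> k \<le> n}. h j k)"
    by (rule prod.reindex_bij_witness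
        [where i = "\<lambda>(j, k). (k - 1, j - 1)" and j = "\<lambda>(k, j). (Suc j, Suc k)"]) auto
  finally show ?thesis ..
qed

section \<open>Integration over the circle\<close>

text \<open>
  Integer powers are continuous, hence bounded, on the circle; this is what makes every moment of
  an integrable weight a convergent integral.
\<close>

lemma circle_integrable_mult_powi:
  assumes "circle_integrable w"
  shows "circle_integrable (\<lambda>\<zeta>. w \<zeta> * \<zeta> powi m)"
proof -
  let ?c = "\<lambda>t. circlepath 0 1 t powi m"
  have "circlepath 0 1 t \<noteq> (0::complex)" for t
    by (simp add: circlepath)
  moreover have "continuous_on {0..1} (circlepath 0 1)"
    using path_circlepath by (simp add: path_def)
  ultimately have cont: "continuous_on {0..1} ?c"
    by (intro continuous_intros) auto
  then have "?c \<in> borel_measurable (lebesgue_on {0..1})"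
    by (rule continuous_imp_measurable_on_sets_lebesgue) auto
  moreover have "bounded (?c ` {0..1})"
    using cont by (intro compact_imp_bounded compact_continuous_image) auto
  ultimately have "(\<lambda>t. ?c t * w (circlepath 0 1 t)) absolutely_integrable_on {0..1}"
    using assms unfolding circle_integrable_def
    by (intro absolutely_integrable_bounded_measurable_product[OF bilinear_times]) auto
  then show ?thesis
    by (simp add: circle_integrable_def mult.commute)
qed

lemma circle_integral_cong:
  assumes "\<And>\<zeta>. norm \<zeta> = 1 \<Longrightarrow> f \<zeta> = g \<zeta>"
  shows "circle_integral f = circle_integral g"
  unfolding circle_integral_def
  by (rule contour_integral_cong) (auto simp: assms)

text \<open>
  The derivative of the parametrisation cancels the factor \<open>1 / (2 * pi * \<i> * \<zeta>)\<close>, so the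
  contour integrand is \<open>f (circlepath 0 1 t)\<close> itself.
\<close>

lemma has_contour_integral_circle_integral:
  assumes "circle_integrable f"
  shows "((\<lambda>\<zeta>. f \<zeta> / (2 * of_real pi * \<i> * \<zeta>)) has_contour_integral circle_integral f)
           (circlepath 0 1)"
proof -
  have "(\<lambda>t. f (circlepath 0 1 t)) integrable_on {0..1}"
    using assms by (simp add: circle_integrable_def absolutely_integrable_on_def)
  then have "(\<lambda>\<zeta>. f \<zeta> / (2 * of_real pi * \<i> * \<zeta>)) contour_integrable_on circlepath 0 1"
    unfolding contour_integrable_on
    by (rule integrable_eq)
       (simp add: vector_derivative_circlepath, simp add: circlepath)
  then show ?thesis
    by (simp add: circle_integral_def has_contour_integral_integral)
qed

lemma circle_integral_sum:
  assumes "finite A" and "\<And>a. a \<in> A \<Longrightarrow> circle_integrable (g a)"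
  shows "circle_integral (\<lambda>\<zeta>. \<Sum>a\<in>A. c a * g a \<zeta>) = (\<Sum>a\<in>A. c a * circle_integral (g a))"
proof -
  have "((\<lambda>\<zeta>. \<Sum>a\<in>A. c a * (g a \<zeta> / (2 * of_real pi * \<i> * \<zeta>))) has_contour_integral
          (\<Sum>a\<in>A. c a * circle_integral (g a))) (circlepath 0 1)"
    using assms
    by (intro has_contour_integral_sum has_contour_integral_lmul
        has_contour_integral_circle_integral) auto
  then show ?thesis
    unfolding circle_integral_def[of "\<lambda>\<zeta>. \<Sum>a\<in>A. c a * g a \<zeta>"]
    by (intro contour_integral_unique) (simp add: sum_divide_distrib)
qed

text \<open>
  Separated variables reduce an iterated integral to one-variable integrals: integrating out the
  innermost variable only multiplies each coefficient \<open>c a\<close> by a constant, which is why \<open>c\<close> is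
  generalised in the induction. The expansion of \<open>F\<close> is required on the torus only, since it may
  fail at points with a vanishing coordinate, where negative powers take default values.
\<close>

lemma iterated_circle_integral_sum_prod:
  assumes "finite A"
    and "\<And>a j. a \<in> A \<Longrightarrow> j < n \<Longrightarrow> circle_integrable (g a j)"
    and "\<And>\<zeta>. (\<And>j. j < n \<Longrightarrow> norm (\<zeta> (Suc j)) = 1) \<Longrightarrow>
           F \<zeta> = (\<Sum>a\<in>A. c a * (\<Prod>j<n. g a j (\<zeta> (Suc j))))"
  shows "iterated_circle_integral n F = (\<Sum>a\<in>A. c a * (\<Prod>j<n. circle_integral (g a j)))"
  using assms(2,3)
proof (induction n arbitrary: F c)
  case 0
  then show ?case by simp
next
  case (Suc n)
  have inner: "circle_integral (\<lambda>x. F (\<zeta>(Suc n := x)))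
      = (\<Sum>a\<in>A. (c a * circle_integral (g a n)) * (\<Prod>j<n. g a j (\<zeta> (Suc j))))"
    if \<zeta>: "\<And>j. j < n \<Longrightarrow> norm (\<zeta> (Suc j)) = 1" for \<zeta>
  proof -
    have "circle_integral (\<lambda>x. F (\<zeta>(Suc n := x)))
        = circle_integral (\<lambda>x. \<Sum>a\<in>A. (c a * (\<Prod>j<n. g a j (\<zeta> (Suc j)))) * g a n x)"
    proof (rule circle_integral_cong)
      fix x :: complex assume "norm x = 1"
      then have "F (\<zeta>(Suc n := x))
          = (\<Sum>a\<in>A. c a * (\<Prod>j<Suc n. g a j ((\<zeta>(Suc n := x)) (Suc j))))"
        using \<zeta> by (intro Suc.prems(2)) (auto simp: less_Suc_eq)
      then show "F (\<zeta>(Suc n := x)) = (\<Sum>a\<in>A. (c a * (\<Prod>j<n. g a j (\<zeta> (Suc j)))) * g a n x)"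
        by (simp add: mult.assoc)
    qed
    also have "\<dots> = (\<Sum>a\<in>A. (c a * (\<Prod>j<n. g a j (\<zeta> (Suc j)))) * circle_integral (g a n))"
      using Suc.prems(1) by (intro circle_integral_sum assms(1)) auto
    finally show ?thesis
      by (simp add: mult_ac)
  qed
  have "iterated_circle_integral n (\<lambda>\<zeta>. circle_integral (\<lambda>x. F (\<zeta>(Suc n := x))))
      = (\<Sum>a\<in>A. (c a * circle_integral (g a n)) * (\<Prod>j<n. circle_integral (g a j)))"
    by (rule Suc.IH[OF _ inner]) (simp_all add: Suc.prems(1))
  then show ?case
    by (simp add: mult_ac)
qed

section \<open>Expansion of the integrand and resummation\<close>

lemma bordered_integrand_expansion:
  fixes w :: "complex \<Rightarrow> complex" and y :: "nat \<Rightarrow> complex"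
  assumes "\<And>j. j < n \<Longrightarrow> y j \<noteq> 0"
  shows "(z1 - z2) *
      ((\<Prod>j<n. w (y j) * y j powi (- r) * (z1 - y j powi (-2)) * (z2 - y j powi (-2))) *
       (\<Prod>k<n. \<Prod>j<k. (y k - y j) * (y k powi (-2) - y j powi (-2))))
    = (\<Sum>(\<tau>, \<sigma>) \<in> {\<tau>. \<tau> permutes {0..<n}} \<times> {\<sigma>. \<sigma> permutes {0..<n + 2}}.
        (signof \<tau> * signof \<sigma> * z2 ^ \<sigma> n * z1 ^ \<sigma> (Suc n)) *
        (\<Prod>j<n. w (y j) * y j powi (- (r + 2 * int (\<sigma> j) - int (\<tau> j)))))"
proof -
  let ?x = "\<lambda>j. y j powi (-2)"
  let ?u = "\<lambda>k. if k < n then ?x k else if k = n then z2 else z1"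
  let ?W = "\<Prod>j<n. w (y j) * y j powi (- r)"
  have "(z1 - z2) *
      ((\<Prod>j<n. w (y j) * y j powi (- r) * (z1 - ?x j) * (z2 - ?x j)) *
       (\<Prod>k<n. \<Prod>j<k. (y k - y j) * (?x k - ?x j)))
    = ?W * (\<Prod>k<n. \<Prod>j<k. y k - y j) *
      ((z1 - z2) * (\<Prod>k<n. (z1 - ?x k) * (z2 - ?x k)) * (\<Prod>k<n. \<Prod>j<k. ?x k - ?x j))"
    by (simp add: prod.distrib mult_ac)
  also have "\<dots> = ?W * det (mat n n (\<lambda>(i, j). y j ^ i)) *
      det (mat (n + 2) (n + 2) (\<lambda>(j, k). ?u k ^ j))"
    unfolding det_bordered_vandermonde by (simp only: det_vandermonde mult.assoc)
  also have "det (mat n n (\<lambda>(i, j). y j ^ i))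
      = (\<Sum>\<tau> | \<tau> permutes {0..<n}. signof \<tau> * (\<Prod>j<n. y j ^ \<tau> j))"
    by (rule det_mat_columns)
  also have "det (mat (n + 2) (n + 2) (\<lambda>(j, k). ?u k ^ j))
      = (\<Sum>\<sigma> | \<sigma> permutes {0..<n + 2}. signof \<sigma> * (\<Prod>k<n + 2. ?u k ^ \<sigma> k))"
    by (rule det_mat_columns)
  also have "?W * (\<Sum>\<tau> | \<tau> permutes {0..<n}. signof \<tau> * (\<Prod>j<n. y j ^ \<tau> j)) *
      (\<Sum>\<sigma> | \<sigma> permutes {0..<n + 2}. signof \<sigma> * (\<Prod>k<n + 2. ?u k ^ \<sigma> k))
    = (\<Sum>(\<tau>, \<sigma>) \<in> {\<tau>. \<tau> permutes {0..<n}} \<times> {\<sigma>. \<sigma> permutes {0..<n + 2}}.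
        ?W * (signof \<tau> * (\<Prod>j<n. y j ^ \<tau> j)) * (signof \<sigma> * (\<Prod>k<n + 2. ?u k ^ \<sigma> k)))"
    by (simp only: mult.assoc sum_product, simp only: sum_distrib_left,
        simp only: sum.cartesian_product)
  also have "\<dots> = (\<Sum>(\<tau>, \<sigma>) \<in> {\<tau>. \<tau> permutes {0..<n}} \<times> {\<sigma>. \<sigma> permutes {0..<n + 2}}.
        (signof \<tau> * signof \<sigma> * z2 ^ \<sigma> n * z1 ^ \<sigma> (Suc n)) *
        (\<Prod>j<n. w (y j) * y j powi (- (r + 2 * int (\<sigma> j) - int (\<tau> j)))))"
  proof (rule sum.cong[OF refl], clarify)
    fix \<tau> \<sigma> :: "nat \<Rightarrow> nat"
    have "y j powi (- (r + 2 * int (\<sigma> j) - int (\<tau> j)))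
        = y j powi (- r) * y j ^ \<tau> j * ?x j ^ \<sigma> j" if "j < n" for j
    proof -
      have "- (r + 2 * int (\<sigma> j) - int (\<tau> j)) = - r + int (\<tau> j) + (-2) * int (\<sigma> j)"
        by simp
      then show ?thesis
        using assms[OF that] by (simp only: power_int_add power_int_mult power_int_of_nat simp_thms)
    qed
    then have "(\<Prod>j<n. w (y j) * y j powi (- (r + 2 * int (\<sigma> j) - int (\<tau> j))))
        = ?W * (\<Prod>j<n. y j ^ \<tau> j) * (\<Prod>j<n. ?x j ^ \<sigma> j)"
      by (simp add: prod.distrib mult_ac)
    moreover have "(\<Prod>k<n + 2. ?u k ^ \<sigma> k) = (\<Prod>j<n. ?x j ^ \<sigma> j) * z2 ^ \<sigma> n * z1 ^ \<sigma> (Suc n)"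
      by simp
    ultimately show "?W * (signof \<tau> * (\<Prod>j<n. y j ^ \<tau> j)) *
          (signof \<sigma> * (\<Prod>k<n + 2. ?u k ^ \<sigma> k))
        = (signof \<tau> * signof \<sigma> * z2 ^ \<sigma> n * z1 ^ \<sigma> (Suc n)) *
          (\<Prod>j<n. w (y j) * y j powi (- (r + 2 * int (\<sigma> j) - int (\<tau> j))))"
      by (simp only: mult_ac)
  qed
  finally show ?thesis .
qed

text \<open>
  The permutation \<open>\<tau>\<close> fixes the indices \<open>n\<close> and \<open>n + 1\<close>, so it moves the moment columns among
  themselves and leaves the two border columns in place.
\<close>

lemma det_bibordered_permuted_columns:
  assumes \<tau>: "\<tau> permutes {0..<n}"
  shows "(\<Sum>\<sigma> | \<sigma> permutes {0..<n + 2}. signof \<sigma> * z2 ^ \<sigma> n * z1 ^ \<sigma> (Suc n) *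
           (\<Prod>j<n. moment w (r + 2 * int (\<sigma> j) - int (\<tau> j))))
         = signof \<tau> * det (bibordered_mat w r n z1 z2)"
proof -
  let ?B = "bibordered_mat w r n z1 z2"
  have B: "?B \<in> carrier_mat (n + 2) (n + 2)"
    by (simp add: bibordered_mat_def)
  have \<tau>': "\<tau> permutes {0..<n + 2}"
    using \<tau> by (rule permutes_subset) auto
  have fixed: "\<tau> n = n" "\<tau> (Suc n) = Suc n"
    using \<tau> by (auto simp: permutes_def)
  have less: "\<tau> j < n" if "j < n" for j
    using permutes_in_image[OF \<tau>, of j] that by simp
  have "signof \<tau> * det ?B = det (mat (n + 2) (n + 2) (\<lambda>(i, j). ?B $$ (i, \<tau> j)))"
    by (rule det_permute_columns[OF B \<tau>', symmetric])
  also have "mat (n + 2) (n + 2) (\<lambda>(i, j). ?B $$ (i, \<tau> j))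
      = mat (n + 2) (n + 2) (\<lambda>(i, j). if j < n then moment w (r + 2 * int i - int (\<tau> j))
          else if j = n then z2 ^ i else z1 ^ i)" (is "_ = mat _ _ (\<lambda>(i, j). ?b i j)")
  proof (rule eq_matI)
    fix i j
    assume "i < dim_row (mat (n + 2) (n + 2) (\<lambda>(i, j). ?b i j))"
      and "j < dim_col (mat (n + 2) (n + 2) (\<lambda>(i, j). ?b i j))"
    then have i: "i < n + 2" and "j < n + 2" by auto
    then consider "j < n" | "j = n" | "j = Suc n" by linarith
    then show "mat (n + 2) (n + 2) (\<lambda>(i, j). ?B $$ (i, \<tau> j)) $$ (i, j)
        = mat (n + 2) (n + 2) (\<lambda>(i, j). ?b i j) $$ (i, j)"
      using i less[of j] by cases (simp_all add: bibordered_mat_def fixed)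
  qed auto
  also have "det (mat (n + 2) (n + 2) (\<lambda>(i, j). ?b i j))
      = (\<Sum>\<sigma> | \<sigma> permutes {0..<n + 2}. signof \<sigma> * (\<Prod>j<n + 2. ?b (\<sigma> j) j))"
    by (rule det_mat_columns)
  finally show ?thesis
    by (simp add: mult_ac)
qed

theorem lemma8:
  fixes w :: "complex \<Rightarrow> complex" and n :: nat and r :: int and z1 z2 :: complex
  assumes "circle_integrable w" and "n \<ge> 1" and "z1 \<noteq> z2"
  shows "F2 w r n z1 z2 =
    circle_D n (\<lambda>\<zeta>. w \<zeta> * \<zeta> powi (- r) * (z1 - \<zeta> powi (-2)) * (z2 - \<zeta> powi (-2)))"
proof -
  let ?T = "{\<tau>. \<tau> permutes {0..<n}}" and ?S = "{\<sigma>. \<sigma> permutes {0..<n + 2}}"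
  let ?D = "det (bibordered_mat w r n z1 z2)"
  let ?g = "\<lambda>(\<tau>, \<sigma>) j \<zeta>. w \<zeta> * \<zeta> powi (- (r + 2 * int (\<sigma> j) - int (\<tau> j)))"
  let ?c = "\<lambda>(\<tau>, \<sigma>). signof \<tau> * signof \<sigma> * z2 ^ \<sigma> n * z1 ^ \<sigma> (Suc n) / (z1 - z2)"
  let ?f = "\<lambda>\<zeta>. w \<zeta> * \<zeta> powi (- r) * (z1 - \<zeta> powi (-2)) * (z2 - \<zeta> powi (-2))"
  define F where "F = (\<lambda>\<zeta>. (\<Prod>j=1..n. ?f (\<zeta> j)) *
     (\<Prod>(j, k) \<in> {(j, k). 1 \<le> j \<and> j < k \<and> k \<le> n}.
        (\<zeta> k - \<zeta> j) * (\<zeta> k powi (-2) - \<zeta> j powi (-2))))"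
  have F_expansion: "F \<zeta> = (\<Sum>a\<in>?T \<times> ?S. ?c a * (\<Prod>j<n. ?g a j (\<zeta> (Suc j))))"
    if \<zeta>: "\<And>j. j < n \<Longrightarrow> norm (\<zeta> (Suc j)) = 1" for \<zeta>
  proof -
    have nz: "\<zeta> (Suc j) \<noteq> 0" if "j < n" for j
      using \<zeta>[OF that] by auto
    have "F \<zeta> = (\<Prod>j<n. ?f (\<zeta> (Suc j))) * (\<Prod>k<n. \<Prod>j<k. (\<zeta> (Suc k) - \<zeta> (Suc j)) *
          (\<zeta> (Suc k) powi (-2) - \<zeta> (Suc j) powi (-2)))"
      unfolding F_def prod_pairs_less by (simp only: One_nat_def prod.atLeast1_atMost_eq)
    then have "(z1 - z2) * F \<zeta> = (\<Sum>(\<tau>, \<sigma>) \<in> ?T \<times> ?S.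
        (signof \<tau> * signof \<sigma> * z2 ^ \<sigma> n * z1 ^ \<sigma> (Suc n)) *
        (\<Prod>j<n. w (\<zeta> (Suc j)) *
          \<zeta> (Suc j) powi (- (r + 2 * int (\<sigma> j) - int (\<tau> j)))))"
      using bordered_integrand_expansion[of n "\<lambda>j. \<zeta> (Suc j)" z1 z2 w r, OF nz] by simp
    then have "F \<zeta> = (\<Sum>(\<tau>, \<sigma>) \<in> ?T \<times> ?S.
        (signof \<tau> * signof \<sigma> * z2 ^ \<sigma> n * z1 ^ \<sigma> (Suc n)) *
        (\<Prod>j<n. w (\<zeta> (Suc j)) *
          \<zeta> (Suc j) powi (- (r + 2 * int (\<sigma> j) - int (\<tau> j))))) / (z1 - z2)"
      using assms(3) by (simp add: field_simps)
    then show ?thesis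
      unfolding sum_divide_distrib by (simp add: case_prod_unfold)
  qed
  have "iterated_circle_integral n F
      = (\<Sum>a\<in>?T \<times> ?S. ?c a * (\<Prod>j<n. circle_integral (?g a j)))"
  proof (rule iterated_circle_integral_sum_prod)
    show "finite (?T \<times> ?S)"
      by (simp add: finite_permutations)
    show "circle_integrable (?g a j)" for a j
      using circle_integrable_mult_powi[OF assms(1)] by (simp add: case_prod_unfold)
  qed (rule F_expansion)
  also have "\<dots> = (\<Sum>\<tau>\<in>?T. \<Sum>\<sigma>\<in>?S. signof \<tau> * signof \<sigma> * z2 ^ \<sigma> n * z1 ^ \<sigma> (Suc n)
      / (z1 - z2) * (\<Prod>j<n. moment w (r + 2 * int (\<sigma> j) - int (\<tau> j))))"
    unfolding sum.cartesian_product by (simp add: case_prod_unfold moment_def)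
  also have "\<dots> = (\<Sum>\<tau>\<in>?T. signof \<tau> / (z1 - z2) *
      (\<Sum>\<sigma>\<in>?S. signof \<sigma> * z2 ^ \<sigma> n * z1 ^ \<sigma> (Suc n) *
        (\<Prod>j<n. moment w (r + 2 * int (\<sigma> j) - int (\<tau> j)))))"
    by (simp add: sum_distrib_left mult_ac)
  also have "\<dots> = (\<Sum>\<tau>\<in>?T. ?D / (z1 - z2))"
  proof (rule sum.cong[OF refl], clarify)
    fix \<tau> assume \<tau>: "\<tau> permutes {0..<n}"
    have "(signof \<tau> :: complex) * signof \<tau> = 1"
      by (simp add: sign_def)
    then show "signof \<tau> / (z1 - z2) *
      (\<Sum>\<sigma>\<in>?S. signof \<sigma> * z2 ^ \<sigma> n * z1 ^ \<sigma> (Suc n) *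
        (\<Prod>j<n. moment w (r + 2 * int (\<sigma> j) - int (\<tau> j)))) = ?D / (z1 - z2)"
      unfolding det_bibordered_permuted_columns[OF \<tau>] by (simp add: field_simps)
  qed
  also have "\<dots> = fact n * F2 w r n z1 z2"
    by (simp add: card_permutations F2_def)
  finally show ?thesis
    unfolding circle_D_def F_def by simp
qed

end
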